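(* Let $n\geq 4$ be an even integer. Then for every integer $r\in[0,n-1]$ there exists a graph $G$ of order $n$ such that $\mathrm{mp}(G)+\mathrm{mp}(\overline{G})=r$. Moreover, this can be realized with $\mathrm{mp}(G)=r$ and $\mathrm{mp}(\overline{G})=0$, for every integer $r\in[0,n-1]$.
   Context: All graphs are finite, simple and undirected; $\overline{G}$ is the complement of $G$. A perfect matching is a set of edges covering every vertex exactly once; an almost-perfect matching is a set of edges covering every vertex except one exactly once and missing the remaining vertex. The matching preclusion number $\mathrm{mp}(G)$ is the minimum number of edges whose deletion leaves a graph with neither a perfect matching nor an almost-perfect matching ($\mathrm{mp}(G)=0$ if $G$ has neither). *)

theory Defs
  imports Main
begin

type_synonym 'a ugraph = "'a set \<times> 'a set set"

abbreviation verts :: "'a ugraph \<Rightarrow> 'a set" where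
  "verts G \<equiv> fst G"

abbreviation edges :: "'a ugraph \<Rightarrow> 'a set set" where
  "edges G \<equiv> snd G"

definition simple_graph :: "'a ugraph \<Rightarrow> bool" where
  "simple_graph G \<longleftrightarrow> finite (verts G) \<and> (\<forall>e \<in> edges G. e \<subseteq> verts G \<and> card e = 2)"

definition complement :: "'a ugraph \<Rightarrow> 'a ugraph" where
  "complement G = (verts G, {e. e \<subseteq> verts G \<and> card e = 2 \<and> e \<notin> edges G})"

definition delete_edges :: "'a ugraph \<Rightarrow> 'a set set \<Rightarrow> 'a ugraph" where
  "delete_edges G F = (verts G, edges G - F)"

definition perfect_matching :: "'a ugraph \<Rightarrow> 'a set set \<Rightarrow> bool" where
  "perfect_matching G M \<longleftrightarrow> M \<subseteq> edges G \<and> (\<forall>v \<in> verts G. \<exists>!e. e \<in> M \<and> v \<in> e)"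

definition almost_perfect_matching :: "'a ugraph \<Rightarrow> 'a set set \<Rightarrow> bool" where
  "almost_perfect_matching G M \<longleftrightarrow> M \<subseteq> edges G \<and>
     (\<exists>w \<in> verts G. (\<forall>e \<in> M. w \<notin> e) \<and> (\<forall>v \<in> verts G - {w}. \<exists>!e. e \<in> M \<and> v \<in> e))"

definition matchable :: "'a ugraph \<Rightarrow> bool" where
  "matchable G \<longleftrightarrow> (\<exists>M. perfect_matching G M \<or> almost_perfect_matching G M)"

text \<open>If \<open>G\<close> itself is not matchable, then \<open>F = {}\<close> is admissible and the value is \<open>0\<close>.
  Deleting all edges is admissible whenever \<open>G\<close> has at least two vertices, so the minimum exists
  then; for orders \<open>0\<close> and \<open>1\<close> no admissible \<open>F\<close> exists and the value is unspecified.\<close>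

definition mp :: "'a ugraph \<Rightarrow> nat" where
  "mp G = (LEAST k. \<exists>F \<subseteq> edges G. card F = k \<and> \<not> matchable (delete_edges G F))"

end

theory Submission imports Defs "HOL-Number_Theory.Cong" begin

text \<open>
  Let \<open>m = n - 1\<close>, which is odd, and let \<open>G\<close> be the complete graph on \<open>{..<m}\<close> together with
  the vertex \<open>m\<close> joined to \<open>0, \<dots>, r - 1\<close>. Deleting the \<open>r\<close> edges at \<open>m\<close> isolates it, so
  \<open>mp G \<le> r\<close>. Conversely, the round-robin 1-factorization of the complete graph of order \<open>n\<close>
  has one factor for each edge \<open>{i, m}\<close>, and for \<open>i < r\<close> this factor lies in \<open>G\<close>; so \<open>G\<close> has
  \<open>r\<close> disjoint perfect matchings, and deleting fewer than \<open>r\<close> edges leaves one of them intact.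
  The complement of \<open>G\<close> is a star with isolated vertices, hence not matchable for \<open>n \<ge> 4\<close>.
\<close>

section \<open>Perfect matchings and the matching preclusion number\<close>

text \<open>The members of \<open>M\<close> are pairwise disjoint pairs with union \<open>W\<close>,
  so counting gives \<open>card W = 2 * card M\<close>.\<close>

lemma even_card_if_matched:
  assumes "finite W" and "\<And>e. e \<in> M \<Longrightarrow> e \<subseteq> W \<and> card e = 2"
    and "\<And>v. v \<in> W \<Longrightarrow> \<exists>!e. e \<in> M \<and> v \<in> e"
  shows "even (card W)"
proof -
  have "\<Union>M = W"
    using assms(2,3) by blast
  moreover have "card (\<Union>M) = sum card M"
  proof (rule card_Union_disjoint)
    show "pairwise disjnt M"
      unfolding pairwise_def disjnt_def using assms(2,3) by blast
    show "finite e" if "e \<in> M" for e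
      using that assms(1,2) finite_subset by blast
  qed
  moreover have "sum card M = 2 * card M"
    using assms(2) by simp
  ultimately show ?thesis by simp
qed

text \<open>An almost-perfect matching pairs up all vertices but one, so by parity it cannot exist
  when the order is even.\<close>

lemma matchable_iff_perfect_matching:
  assumes G: "simple_graph G" and ev: "even (card (verts G))"
  shows "matchable G \<longleftrightarrow> (\<exists>M. perfect_matching G M)"
proof -
  have False if M: "almost_perfect_matching G M" for M
  proof -
    obtain w where w: "w \<in> verts G" "M \<subseteq> edges G" "\<forall>e\<in>M. w \<notin> e"
      "\<forall>v \<in> verts G - {w}. \<exists>!e. e \<in> M \<and> v \<in> e"
      using M unfolding almost_perfect_matching_def by blast
    have "even (card (verts G - {w}))"
      by (rule even_card_if_matched[where M = M])
        (use w G in \<open>auto simp: simple_graph_def\<close>)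
    moreover have "card (verts G) = Suc (card (verts G - {w}))"
      using G w(1) unfolding simple_graph_def by (metis card.remove)
    ultimately show False using ev by simp
  qed
  then show ?thesis unfolding matchable_def by blast
qed

text \<open>\<open>F\<close> supplies the upper bound and also the witness without which
  \<open>LEAST\<close> would be unspecified; the last hypothesis is the lower bound.\<close>

lemma mp_eqI:
  assumes "F \<subseteq> edges G" and "\<not> matchable (delete_edges G F)"
    and "\<And>F'. F' \<subseteq> edges G \<Longrightarrow> card F' < card F \<Longrightarrow> matchable (delete_edges G F')"
  shows "mp G = card F"
  unfolding mp_def
proof (rule Least_equality)
  show "\<exists>F'\<subseteq>edges G. card F' = card F \<and> \<not> matchable (delete_edges G F')"
    using assms(1,2) by blast
  show "card F \<le> k" if "\<exists>F'\<subseteq>edges G. card F' = k \<and> \<not> matchable (delete_edges G F')" for k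
    using that assms(3) not_less by blast
qed

lemma mp_eq_0: "\<not> matchable G \<Longrightarrow> mp G = 0"
  using mp_eqI[of "{}" G] by (simp add: delete_edges_def)

lemma simple_graph_complement: "simple_graph G \<Longrightarrow> simple_graph (complement G)"
  by (auto simp: simple_graph_def complement_def)

text \<open>If \<open>v = f u\<close>, then \<open>f v = u\<close>, so every pair containing
  \<open>v\<close> is \<open>{v, f v}\<close>.\<close>

lemma perfect_matching_involution:
  assumes "\<And>v. v \<in> verts G \<Longrightarrow> f v \<in> verts G \<and> f (f v) = v \<and> {v, f v} \<in> edges G"
  shows "perfect_matching G ((\<lambda>v. {v, f v}) ` verts G)"
  unfolding perfect_matching_def
proof (intro conjI ballI)
  show "(\<lambda>v. {v, f v}) ` verts G \<subseteq> edges G"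
    using assms by blast
  fix v assume v: "v \<in> verts G"
  show "\<exists>!e. e \<in> (\<lambda>v. {v, f v}) ` verts G \<and> v \<in> e"
  proof (rule ex1I[of _ "{v, f v}"])
    show "{v, f v} \<in> (\<lambda>v. {v, f v}) ` verts G \<and> v \<in> {v, f v}"
      using v by blast
  next
    fix e assume "e \<in> (\<lambda>v. {v, f v}) ` verts G \<and> v \<in> e"
    then obtain u where "u \<in> verts G" "e = {u, f u}" "v \<in> {u, f u}" by blast
    then show "e = {v, f v}" using assms[of u] by auto
  qed
qed

text \<open>Pigeonhole: if \<open>F\<close> met every \<open>M i\<close>, choosing a common edge for
  each \<open>i\<close> would inject \<open>I\<close> into the smaller set \<open>F\<close>. A
  matching that avoids \<open>F\<close> survives the deletion.\<close>

lemma delete_few_edges_matchable: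
  assumes I: "finite I" and F: "finite F" "card F < card I"
    and M: "\<And>i. i \<in> I \<Longrightarrow> perfect_matching G (M i)"
    and disj: "\<And>i j. i \<in> I \<Longrightarrow> j \<in> I \<Longrightarrow> i \<noteq> j \<Longrightarrow> M i \<inter> M j = {}"
  shows "matchable (delete_edges G F)"
proof -
  have "\<exists>i\<in>I. M i \<inter> F = {}"
  proof (rule ccontr)
    assume "\<not> ?thesis"
    then have "\<forall>i\<in>I. \<exists>e. e \<in> M i \<inter> F" by blast
    then obtain h where h: "\<And>i. i \<in> I \<Longrightarrow> h i \<in> M i \<inter> F" by metis
    have "inj_on h I"
      by (rule inj_onI) (use h disj in \<open>metis IntD1 IntI empty_iff\<close>)
    moreover have "h ` I \<subseteq> F" using h by blast
    ultimately show False using F card_inj_on_le[of h I F] by simp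
  qed
  then obtain i where "i \<in> I" "M i \<inter> F = {}" by blast
  then have "perfect_matching (delete_edges G F) (M i)"
    using M[of i] by (auto simp: perfect_matching_def delete_edges_def)
  then show ?thesis unfolding matchable_def by blast
qed

section \<open>The round-robin factorization\<close>

text \<open>In round \<open>i < m\<close>, a vertex \<open>a < m\<close> with \<open>a \<noteq> i\<close> is paired with the \<open>b < m\<close> such that
  \<open>a + b\<close> and \<open>2 * i\<close> are congruent modulo \<open>m\<close>; the summand \<open>m\<close> prevents truncated subtraction.\<close>

definition round_robin :: "nat \<Rightarrow> nat \<Rightarrow> nat \<Rightarrow> nat" where
  "round_robin m i a = (if a = m then i else if a = i then m else (2 * i + m - a) mod m)"

text \<open>\<open>2\<close> is invertible modulo an odd \<open>m\<close>, and \<open>i\<close> and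
  \<open>j\<close> are reduced residues in \<open>{..<m}\<close>.\<close>

lemma cong_double_imp_eq:
  fixes m i j :: nat
  assumes "odd m" "i < m" "j < m" "[2 * i = 2 * j] (mod m)"
  shows "i = j"
proof -
  have "coprime 2 m" using assms(1) by simp
  then have "[i = j] (mod m)" using assms(4) cong_mult_lcancel_nat by blast
  then show ?thesis using assms(2,3) by (simp add: cong_def)
qed

lemma cong_round_robin:
  assumes "a < m" "a \<noteq> i"
  shows "[a + round_robin m i a = 2 * i] (mod m)"
proof -
  have "[a + (2 * i + m - a) mod m = a + (2 * i + m - a)] (mod m)"
    by (simp add: cong_def mod_add_right_eq)
  also have "a + (2 * i + m - a) = 2 * i + m" using assms by simp
  finally show ?thesis using assms by (simp add: round_robin_def cong_def)
qed

lemma round_robin_less: "a < m \<Longrightarrow> a \<noteq> i \<Longrightarrow> round_robin m i a < m"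
  by (simp add: round_robin_def)

lemma round_robin_le: "i < m \<Longrightarrow> a \<le> m \<Longrightarrow> round_robin m i a \<le> m"
  by (cases "a = m \<or> a = i") (auto simp: round_robin_def less_imp_le)

text \<open>A fixed point \<open>a\<close> outside \<open>{i, m}\<close> would satisfy
  \<open>2 * a \<equiv> 2 * i\<close> modulo \<open>m\<close>, forcing \<open>a = i\<close>.\<close>

lemma round_robin_neq:
  assumes "odd m" "i < m" "a \<le> m"
  shows "round_robin m i a \<noteq> a"
proof (cases "a = m \<or> a = i")
  case False
  then have "[a + round_robin m i a = 2 * i] (mod m)"
    using assms by (intro cong_round_robin) auto
  then show ?thesis
    using cong_double_imp_eq[of m a i] assms False by (auto simp: mult_2)
qed (use assms in \<open>auto simp: round_robin_def\<close>)

text \<open>The congruence \<open>a + b \<equiv> 2 * i\<close> is symmetric in \<open>a\<close> and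
  \<open>b\<close>, so \<open>a\<close> and the partner of \<open>b\<close> agree modulo
  \<open>m\<close>; both are below \<open>m\<close>.\<close>

lemma round_robin_involution:
  assumes "odd m" "i < m" "a \<le> m"
  shows "round_robin m i (round_robin m i a) = a"
proof (cases "a = m \<or> a = i")
  case False
  define b where "b = round_robin m i a"
  have ab: "a < m" "a \<noteq> i" "b < m" "[a + b = 2 * i] (mod m)"
    using False assms round_robin_less cong_round_robin by (auto simp: b_def)
  \<comment> \<open>This keeps \<open>b\<close> out of the branch that returns \<open>m\<close>, so
    the congruence applies to \<open>b\<close> as well.\<close>
  have "b \<noteq> i"
  proof
    assume "b = i"
    then have "[a + i = i + i] (mod m)" using ab(4) by (simp add: mult_2)
    then have "[a = i] (mod m)" by (simp add: cong_add_rcancel_nat)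
    then show False using ab assms by (simp add: cong_def)
  qed
  then have "round_robin m i b < m" "[b + round_robin m i b = 2 * i] (mod m)"
    using ab round_robin_less cong_round_robin by auto
  then have "[b + round_robin m i b = b + a] (mod m)"
    using ab(4) by (simp add: cong_def add.commute)
  then have "[round_robin m i b = a] (mod m)" by (simp add: cong_add_lcancel_nat)
  then show ?thesis
    using \<open>round_robin m i b < m\<close> ab(1) by (simp add: cong_def b_def)
qed (use assms in \<open>auto simp: round_robin_def\<close>)

text \<open>For \<open>a < m\<close> other than \<open>i\<close> and \<open>j\<close>, the common
  partner gives \<open>2 * i \<equiv> 2 * j\<close>. If \<open>a\<close> is \<open>i\<close> or
  \<open>j\<close>, the case is settled because \<open>a\<close> has partner \<open>m\<close> only
  in round \<open>a\<close>.\<close>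

lemma round_robin_eq_imp_eq:
  assumes "odd m" "i < m" "j < m" "a \<le> m" "round_robin m i a = round_robin m j a"
  shows "i = j"
proof -
  consider "a = m" | "a < m" "a = i \<or> a = j" | "a < m" "a \<noteq> i" "a \<noteq> j"
    using assms(4) by linarith
  then show ?thesis
  proof cases
    case 2
    then show ?thesis
      using assms(5) round_robin_less[of a m] by (metis less_irrefl round_robin_def)
  next
    case 3
    then have "[2 * i = 2 * j] (mod m)"
      using cong_round_robin[of a m i] cong_round_robin[of a m j] assms(5)
      by (simp add: cong_def)
    then show ?thesis using assms cong_double_imp_eq by blast
  qed (use assms in \<open>simp add: round_robin_def\<close>)
qed

definition round_robin_matching :: "nat \<Rightarrow> nat \<Rightarrow> nat set set" where
  "round_robin_matching m i = (\<lambda>a. {a, round_robin m i a}) ` {..m}"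

text \<open>An edge shared by two rounds would give its end \<open>a\<close> the same partner in
  both; the involution handles the two ways of ordering the ends.\<close>

lemma round_robin_matching_disjoint:
  assumes "odd m" "i < m" "j < m" "i \<noteq> j"
  shows "round_robin_matching m i \<inter> round_robin_matching m j = {}"
proof -
  have False if ab: "a \<le> m" "b \<le> m" "{a, round_robin m i a} = {b, round_robin m j b}" for a b
  proof -
    have "round_robin m i a = round_robin m j a"
      using ab(3) round_robin_involution[of m j b] assms ab(2) by (auto simp: doubleton_eq_iff)
    then show False using round_robin_eq_imp_eq assms ab by blast
  qed
  then show ?thesis unfolding round_robin_matching_def by blast
qed

section \<open>The clique with an apex and its complement\<close>

definition clique_with_apex :: "nat \<Rightarrow> nat \<Rightarrow> nat ugraph" where
  "clique_with_apex m r = ({..m}, {e. e \<subseteq> {..<m} \<and> card e = 2} \<union> (\<lambda>i. {i, m}) ` {..<r})"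

lemma simple_graph_clique_with_apex:
  assumes "r \<le> m"
  shows "simple_graph (clique_with_apex m r)"
  using assms by (fastforce simp: simple_graph_def clique_with_apex_def card_2_iff)

text \<open>Round \<open>i\<close> uses only the edge \<open>{i, m}\<close> at the apex, present
  because \<open>i < r\<close>; its other edges lie in the clique.\<close>

lemma perfect_matching_round_robin:
  assumes "odd m" "r \<le> m" "i < r"
  shows "perfect_matching (clique_with_apex m r) (round_robin_matching m i)"
proof -
  let ?G = "clique_with_apex m r"
  have "round_robin m i a \<in> verts ?G \<and> round_robin m i (round_robin m i a) = a
      \<and> {a, round_robin m i a} \<in> edges ?G" if "a \<in> verts ?G" for a
  proof -
    have a: "a \<le> m" and i: "i < m"
      using that assms by (auto simp: clique_with_apex_def)
    have "{a, round_robin m i a} \<in> edges ?G"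
    proof (cases "a = m \<or> a = i")
      case True
      then have "{a, round_robin m i a} = {i, m}" by (auto simp: round_robin_def)
      then show ?thesis using assms(3) by (auto simp: clique_with_apex_def)
    next
      case False
      then show ?thesis
        using a round_robin_less[of a m i] round_robin_neq[OF assms(1) i a]
        by (auto simp: clique_with_apex_def)
    qed
    then show ?thesis
      using round_robin_le[OF i a] round_robin_involution[OF assms(1) i a]
      by (simp add: clique_with_apex_def)
  qed
  from perfect_matching_involution[OF this]
  show ?thesis by (simp add: round_robin_matching_def clique_with_apex_def)
qed

lemma mp_clique_with_apex:
  assumes "odd m" "r \<le> m"
  shows "mp (clique_with_apex m r) = r"
proof -
  let ?G = "clique_with_apex m r"
  let ?F = "(\<lambda>i. {i, m}) ` {..<r}"
  have G: "simple_graph ?G" using assms by (simp add: simple_graph_clique_with_apex)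
  have "inj_on (\<lambda>i. {i, m}) {..<r}"
    by (auto simp: inj_on_def doubleton_eq_iff)
  then have card_F: "card ?F = r" by (simp add: card_image)
  have "mp ?G = card ?F"
  proof (rule mp_eqI)
    show "?F \<subseteq> edges ?G" by (auto simp: clique_with_apex_def)
    have "simple_graph (delete_edges ?G ?F)"
      using G by (auto simp: simple_graph_def delete_edges_def)
    \<comment> \<open>Even order excludes almost-perfect matchings, in particular those missing only
      the isolated vertex \<open>m\<close>.\<close>
    moreover have "even (card (verts (delete_edges ?G ?F)))"
      using assms(1) by (simp add: delete_edges_def clique_with_apex_def)
    moreover have "\<not> perfect_matching (delete_edges ?G ?F) M" for M
    proof
      assume M: "perfect_matching (delete_edges ?G ?F) M"
      then have "\<exists>!e. e \<in> M \<and> m \<in> e"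
        by (simp add: perfect_matching_def delete_edges_def clique_with_apex_def)
      then obtain e where "e \<in> M" "m \<in> e" by blast
      then show False
        using M by (auto simp: perfect_matching_def delete_edges_def clique_with_apex_def)
    qed
    ultimately show "\<not> matchable (delete_edges ?G ?F)"
      using matchable_iff_perfect_matching by blast
  next
    fix F' assume F': "F' \<subseteq> edges ?G" "card F' < card ?F"
    \<comment> \<open>Infinite sets have \<open>card\<close> equal to \<open>0\<close>, so the bound
      on \<open>card F'\<close> alone would not give the finiteness used by the pigeonhole
      argument.\<close>
    have "edges ?G \<subseteq> Pow (verts ?G)" "finite (verts ?G)"
      using G by (auto simp: simple_graph_def)
    then have "finite F'" using F'(1) by (meson finite_Pow_iff finite_subset)
    show "matchable (delete_edges ?G F')"
    proof (rule delete_few_edges_matchable[OF finite_lessThan \<open>finite F'\<close>])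
      show "card F' < card {..<r}" using F'(2) card_F by simp
      show "perfect_matching ?G (round_robin_matching m i)" if "i \<in> {..<r}" for i
        using that assms by (simp add: perfect_matching_round_robin)
      show "round_robin_matching m i \<inter> round_robin_matching m j = {}"
        if "i \<in> {..<r}" "j \<in> {..<r}" "i \<noteq> j" for i j
        using that assms by (intro round_robin_matching_disjoint) auto
    qed
  qed
  then show ?thesis using card_F by simp
qed

text \<open>The edges matching \<open>0\<close> and \<open>1\<close> both contain \<open>m\<close>,
  so uniqueness at \<open>m\<close> makes them a single edge. It would contain \<open>0\<close>,
  \<open>1\<close> and \<open>m\<close>, which are distinct because
  \<open>m \<ge> 2\<close>.\<close>

lemma mp_complement_clique_with_apex:
  assumes "odd m" "r \<le> m" "m \<ge> 2"
  shows "mp (complement (clique_with_apex m r)) = 0"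
proof (rule mp_eq_0)
  let ?H = "complement (clique_with_apex m r)"
  have H: "simple_graph ?H"
    using assms by (simp add: simple_graph_complement simple_graph_clique_with_apex)
  have ev: "even (card (verts ?H))"
    using assms(1) by (simp add: complement_def clique_with_apex_def)
  \<comment> \<open>All pairs inside \<open>{..<m}\<close> are edges of the clique, so a pair in the
    complement must leave \<open>{..<m}\<close>.\<close>
  have apex: "m \<in> e \<and> card e = 2" if "e \<in> edges ?H" for e
  proof -
    have e: "e \<subseteq> {..m}" "card e = 2" "\<not> e \<subseteq> {..<m}"
      using that by (auto simp: complement_def clique_with_apex_def)
    then obtain x where "x \<in> e" "\<not> x < m" by blast
    with e(1) have "x = m" by (metis atMost_iff le_neq_implies_less subsetD)
    with \<open>x \<in> e\<close> e(2) show ?thesis by simp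
  qed
  have "\<not> perfect_matching ?H M" for M
  proof
    assume M: "perfect_matching ?H M"
    then have ex1: "\<exists>!e. e \<in> M \<and> v \<in> e" if "v \<le> m" for v
      using that by (simp add: perfect_matching_def complement_def clique_with_apex_def)
    obtain e f where ef: "e \<in> M" "0 \<in> e" "f \<in> M" "1 \<in> f"
      using ex1[of 0] ex1[of 1] assms(3) by auto
    have "m \<in> e" "m \<in> f" "card e = 2"
      using apex ef M by (auto simp: perfect_matching_def)
    with ef ex1[of m] have "{0, 1, m} \<subseteq> e" by blast
    moreover have "finite e" using \<open>card e = 2\<close> card.infinite by fastforce
    ultimately have "card {0, 1, m} \<le> 2" using \<open>card e = 2\<close> card_mono by metis
    then show False using assms(3) by simp
  qed
  then show "\<not> matchable ?H" using matchable_iff_perfect_matching[OF H ev] by blast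
qed

theorem theorem5p7:
  fixes n :: nat
  assumes "n \<ge> 4" and "even n"
  shows "(\<forall>r \<in> {0..n - 1}. \<exists>G :: nat ugraph. simple_graph G \<and> card (verts G) = n \<and>
            mp G + mp (complement G) = r)
       \<and> (\<forall>r \<in> {0..n - 1}. \<exists>G :: nat ugraph. simple_graph G \<and> card (verts G) = n \<and>
            mp G = r \<and> mp (complement G) = 0)"
proof -
  have "\<exists>G :: nat ugraph. simple_graph G \<and> card (verts G) = n \<and> mp G = r \<and> mp (complement G) = 0"
    if "r \<in> {0..n - 1}" for r
  proof (intro exI conjI)
    let ?G = "clique_with_apex (n - 1) r"
    have "odd (n - 1)" "r \<le> n - 1" "n - 1 \<ge> 2"
      using assms that by auto
    then show "simple_graph ?G" "mp ?G = r" "mp (complement ?G) = 0"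
      by (simp_all add: simple_graph_clique_with_apex mp_clique_with_apex
          mp_complement_clique_with_apex)
    show "card (verts ?G) = n" using assms(1) by (simp add: clique_with_apex_def)
  qed
  \<comment> \<open>The same graphs settle the claim about sums, since
    \<open>r + 0 = r\<close>.\<close>
  then show ?thesis by (metis add.right_neutral)
qed

end
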